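(* Let $G\leq \mathrm{GL}(d,\mathbb{R})$ be a finite group such that at least one orbit polytope of $G$ is full-dimensional. Then: (1) The set of points of $\mathbb{R}^d$ that are not generic for $G$ is the set of common zeros of a non-empty set of non-zero polynomials in $\mathbb{R}[X_1,\dotsc,X_d]$. (2) The affine symmetry groups $\mathrm{AGL}(P(G,v))$, where $v$ runs over the points generic for $G$, are all conjugate in $\mathrm{GL}(d,\mathbb{R})$. (3) For every $v\in\mathbb{R}^d$ such that $P(G,v)$ is full-dimensional and every point $w$ generic for $G$, the group $\mathrm{AGL}(P(G,v))$ contains a conjugate (in $\mathrm{GL}(d,\mathbb{R})$) of $\mathrm{AGL}(P(G,w))$.
   Context: For a finite group $G\leq\mathrm{GL}(d,\mathbb{R})$ and $v\in\mathbb{R}^d$, the orbit polytope is $P(G,v)=\operatorname{conv}\{gv\mid g\in G\}$; it is full-dimensional if the affine hull of $Gv=\{gv\mid g\in G\}$ is $\mathbb{R}^d$. An affine symmetry of a polytope $P\subset\mathbb{R}^d$ is a bijection of $P$ that is the restriction of an affine map $\mathbb{R}^d\to\mathbb{R}^d$; $\mathrm{AGL}(P)$ is the group of affine symmetries. If $P(G,v)$ is full-dimensional, its barycenter is the origin, so each affine symmetry is the restriction of a unique element of $\mathrm{GL}(d,\mathbb{R})$, and $\mathrm{AGL}(P(G,v))$ is regarded as a subgroup of $\mathrm{GL}(d,\mathbb{R})$. For a field $K$, a finite set $I$ and a family $(v_i)_{i\in I}$ of vectors in $K^d$, put $\mathrm{LinSym}((v_i)_i)=\{\sigma\in\mathrm{Sym}(I)\mid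 \exists A\in\mathrm{GL}(d,K)\ \forall i\in I:\ Av_i=v_{\sigma(i)}\}$. Let $X=(X_1,\dotsc,X_d)^t$ be a vector of indeterminates, viewed as an element of $K^d$ with $K=\mathbb{R}(X_1,\dotsc,X_d)$; then $(gX)_{g\in G}$ is a family of vectors in $K^d$ indexed by $G$. If at least one orbit polytope of $G$ is full-dimensional, a point $v\in\mathbb{R}^d$ is called generic for $G$ if $P(G,v)$ is full-dimensional, $v$ has trivial stabilizer in $G$, and $\mathrm{LinSym}((gX)_{g\in G})=\mathrm{LinSym}((gv)_{g\in G})$ (the first computed over $K=\mathbb{R}(X_1,\dotsc,X_d)$, the second over $\mathbb{R}$). *)

theory Defs
  imports
    "HOL-Analysis.Analysis"
    "HOL-Algebra.Coset"
    "HOL-Library.Poly_Mapping"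
    "HOL-Computational_Algebra.Polynomial_Factorial"
begin

definition GL :: "('k::field ^ 'n ^ 'n) monoid" where
  "GL = \<lparr>carrier = {A. invertible A}, mult = (**), one = mat 1\<rparr>"

lemma group_GL: "group (GL :: ('k::field ^ 'n ^ 'n) monoid)"
proof (rule groupI)
  fix A :: "'k ^ 'n ^ 'n" assume "A \<in> carrier GL"
  then obtain B where "A ** B = mat 1" "B ** A = mat 1"
    by (auto simp: GL_def invertible_def)
  then show "\<exists>y\<in>carrier GL. y \<otimes>\<^bsub>GL\<^esub> A = \<one>\<^bsub>GL\<^esub>"
    by (auto simp: GL_def invertible_def)
next
  have "invertible (mat 1 :: 'k ^ 'n ^ 'n)"
    unfolding invertible_def by (intro exI[of _ "mat 1"]) simp
  then show "\<one>\<^bsub>GL\<^esub> \<in> carrier (GL :: ('k ^ 'n ^ 'n) monoid)"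
    by (simp add: GL_def)
qed (auto simp: GL_def invertible_mult matrix_mul_assoc)

definition conjugate_by :: "'k::field ^ 'n ^ 'n \<Rightarrow> ('k ^ 'n ^ 'n) set \<Rightarrow> ('k ^ 'n ^ 'n) set" where
  "conjugate_by A H = (\<lambda>B. A \<otimes>\<^bsub>GL\<^esub> B \<otimes>\<^bsub>GL\<^esub> inv\<^bsub>GL\<^esub> A) ` H"

definition orbit_polytope :: "(real ^ 'n ^ 'n) set \<Rightarrow> real ^ 'n \<Rightarrow> (real ^ 'n) set" where
  "orbit_polytope G v = convex hull ((\<lambda>g. g *v v) ` G)"

definition full_dimensional :: "(real ^ 'n ^ 'n) set \<Rightarrow> real ^ 'n \<Rightarrow> bool" where
  "full_dimensional G v \<longleftrightarrow> affine hull ((\<lambda>g. g *v v) ` G) = UNIV"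

text \<open>
  Maps on \<open>P\<close> are represented as functions that are \<^const>\<open>undefined\<close> outside \<open>P\<close>, so that
  distinct affine maps with the same restriction to \<open>P\<close> give the same affine symmetry.
\<close>

definition affine_symmetries :: "(real ^ 'n) set \<Rightarrow> (real ^ 'n \<Rightarrow> real ^ 'n) set" where
  "affine_symmetries P =
     {f. bij_betw f P P \<and> (\<exists>L b. linear L \<and> f = restrict (\<lambda>x. L x + b) P)}"

text \<open>
  \<open>AGL P\<close> is the affine symmetry group viewed inside \<^const>\<open>GL\<close>. It represents all affine
  symmetries of \<open>P\<close> when these extend uniquely to elements of \<^const>\<open>GL\<close>, in particular for
  full-dimensional orbit polytopes.
\<close>

definition AGL :: "(real ^ 'n) set \<Rightarrow> (real ^ 'n ^ 'n) set" where
  "AGL P = {A \<in> carrier GL. restrict (\<lambda>x. A *v x) P \<in> affine_symmetries P}"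

definition LinSym :: "'i set \<Rightarrow> ('i \<Rightarrow> 'k::field ^ 'n) \<Rightarrow> ('i \<Rightarrow> 'i) set" where
  "LinSym I v = {\<sigma>. \<sigma> permutes I \<and> (\<exists>A\<in>carrier GL. \<forall>i\<in>I. A *v v i = v (\<sigma> i))}"

text \<open>
  Real polynomials in indeterminates indexed by \<open>'n\<close>, as finitely supported functions from
  exponent vectors to coefficients. A linear order on \<open>'n\<close> is what the library needs in order
  to turn this ring into an integral domain.
\<close>

type_synonym 'n real_mpoly = "('n \<Rightarrow>\<^sub>0 nat) \<Rightarrow>\<^sub>0 real"

type_synonym 'n real_ratfun = "'n real_mpoly fract"

definition eval_mpoly :: "'n::finite real_mpoly \<Rightarrow> real ^ 'n \<Rightarrow> real" where
  "eval_mpoly p v =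
     (\<Sum>m\<in>Poly_Mapping.keys p. Poly_Mapping.lookup p m *
        (\<Prod>i\<in>UNIV. (v $ i) ^ Poly_Mapping.lookup m i))"

definition ratfun_const :: "real \<Rightarrow> 'n::linorder real_ratfun" where
  "ratfun_const c = to_fract (Poly_Mapping.single 0 c)"

definition ratfun_var :: "'n::linorder \<Rightarrow> 'n real_ratfun" where
  "ratfun_var i = to_fract (Poly_Mapping.single (Poly_Mapping.single i 1) 1)"

definition generic_vector :: "'n real_ratfun ^ ('n::{finite,linorder})" where
  "generic_vector = (\<chi> i. ratfun_var i)"

definition ratfun_matrix :: "real ^ ('n::{finite,linorder}) ^ ('n::{finite,linorder}) \<Rightarrow> 'n real_ratfun ^ ('n::{finite,linorder}) ^ ('n::{finite,linorder})" where
  "ratfun_matrix g = (\<chi> i j. ratfun_const (g $ i $ j))"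

definition generic :: "(real ^ ('n::{finite,linorder}) ^ ('n::{finite,linorder})) set \<Rightarrow> real ^ ('n::{finite,linorder}) \<Rightarrow> bool" where
  "generic G v \<longleftrightarrow>
     full_dimensional G v \<and>
     {g \<in> G. g *v v = v} = {mat 1} \<and>
     LinSym G (\<lambda>g. ratfun_matrix g *v generic_vector) = LinSym G (\<lambda>g. g *v v)"

end

theory Submission
  imports Defs
begin

text \<open>
  Write \<open>H\<close> for the group of linear symmetries of the generic orbit. By Cramer's rule, a permutation is
  a linear symmetry of a spanning family iff certain polynomial expressions in the family vanish.
  Hence \<open>H\<close> acts linearly on every full-dimensional orbit \<open>Gv\<close>, by matrices \<open>A\<^sub>\<sigma>(v)\<close>, and the generic
  points form a finite intersection of non-empty Zariski-open sets, which is non-empty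
  because the polynomial ring is a domain and \<open>\<real>\<close> is infinite.

  For generic \<open>w\<close> the affine symmetries of the orbit polytope are exactly the \<open>A\<^sub>\<sigma>(w)\<close>, so everything
  reduces to the equivalence of the representations \<open>A(v)\<close> and \<open>A(w)\<close> of \<open>H\<close>. The average
  \<open>\<Sum>\<^sub>\<sigma> A\<^sub>\<sigma>(x) A\<^sub>\<sigma>(w)\<^sup>-\<^sup>1\<close> intertwines \<open>A(x)\<close> and \<open>A(w)\<close>; it is a rational function of \<open>x\<close> and invertible at
  \<open>x = w\<close>, so it is invertible on a non-empty Zariski-open set of points \<open>x\<close>. The
  corresponding sets for \<open>v\<close> and \<open>w\<close> intersect.
\<close>

section \<open>Polynomial functions and Zariski-open sets\<close>

lemma eval_mpoly_superset:
  assumes "finite K" "Poly_Mapping.keys p \<subseteq> K"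
  shows "eval_mpoly p v =
     (\<Sum>m\<in>K. Poly_Mapping.lookup p m * (\<Prod>i\<in>UNIV. (v $ i) ^ Poly_Mapping.lookup m i))"
  unfolding eval_mpoly_def
  by (rule sum.mono_neutral_left) (use assms in \<open>auto simp: in_keys_iff\<close>)

lemma eval_mpoly_single:
  "eval_mpoly (Poly_Mapping.single m c) v = c * (\<Prod>i\<in>UNIV. (v $ i) ^ Poly_Mapping.lookup m i)"
  by (subst eval_mpoly_superset[of "{m}"]) auto

lemma eval_mpoly_0 [simp]: "eval_mpoly 0 v = 0"
  by (simp add: eval_mpoly_def)

lemma eval_mpoly_add: "eval_mpoly (p + q) v = eval_mpoly p v + eval_mpoly q v"
proof -
  let ?K = "Poly_Mapping.keys p \<union> Poly_Mapping.keys q"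
  show ?thesis
    using Poly_Mapping.keys_add[of p q]
    by (subst (1 2 3) eval_mpoly_superset[of ?K])
       (auto simp: lookup_add algebra_simps sum.distrib)
qed

lemma eval_mpoly_uminus: "eval_mpoly (- p) v = - eval_mpoly p v"
  using eval_mpoly_add[of p "- p" v] by simp

lemma eval_mpoly_sum: "eval_mpoly (sum f A) v = (\<Sum>a\<in>A. eval_mpoly (f a) v)"
  by (induction A rule: infinite_finite_induct) (auto simp: eval_mpoly_add)

lemma poly_mapping_sum_single:
  "(\<Sum>m\<in>Poly_Mapping.keys p. Poly_Mapping.single m (Poly_Mapping.lookup p m)) = p"
  by (rule poly_mapping_eqI)
     (auto simp: lookup_sum lookup_single when_def in_keys_iff sum.delta')

lemma eval_mpoly_mult: "eval_mpoly (p * q) v = eval_mpoly p v * eval_mpoly q v"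
proof -
  let ?s = "\<lambda>p m. Poly_Mapping.single m (Poly_Mapping.lookup p m)"
  have "p * q = (\<Sum>m\<in>Poly_Mapping.keys p. \<Sum>n\<in>Poly_Mapping.keys q. ?s p m * ?s q n)"
    by (subst (1 2) poly_mapping_sum_single[symmetric]) (simp add: sum_product)
  then have "eval_mpoly (p * q) v =
      (\<Sum>m\<in>Poly_Mapping.keys p. \<Sum>n\<in>Poly_Mapping.keys q. eval_mpoly (?s p m) v * eval_mpoly (?s q n) v)"
    by (simp add: eval_mpoly_sum mult_single eval_mpoly_single lookup_add power_add prod.distrib algebra_simps)
  also have "\<dots> = eval_mpoly (\<Sum>m\<in>Poly_Mapping.keys p. ?s p m) v * eval_mpoly (\<Sum>m\<in>Poly_Mapping.keys q. ?s q m) v"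
    by (simp add: eval_mpoly_sum sum_product)
  finally show ?thesis by (simp add: poly_mapping_sum_single)
qed

text \<open>Mixed-radix encoding by induction on \<open>J\<close>: the new index gets a base
  \<open>N\<close> exceeding all earlier weighted sums, so the new exponent is the quotient by
  \<open>N\<close> and the earlier sum the remainder.\<close>

lemma separating_weights:
  fixes F :: "('n \<Rightarrow> nat) set"
  assumes "finite J" "finite F"
  shows "\<exists>a. \<forall>m\<in>F. \<forall>m'\<in>F. (\<Sum>i\<in>J. a i * m i) = (\<Sum>i\<in>J. a i * m' i) \<longrightarrow> (\<forall>i\<in>J. m i = m' i)"
  using assms(1)
proof (induction J)
  case empty
  show ?case by simp
next
  case (insert j J)
  then obtain a :: "'n \<Rightarrow> nat" where
    a: "\<And>m m'. \<lbrakk>m \<in> F; m' \<in> F; (\<Sum>i\<in>J. a i * m i) = (\<Sum>i\<in>J. a i * m' i)\<rbrakk> \<Longrightarrow> \<forall>i\<in>J. m i = m' i"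
    by meson
  let ?s = "\<lambda>m. \<Sum>i\<in>J. a i * m i"
  \<comment> \<open>The successor makes the bound strict, as a remainder requires. For empty
    \<open>F\<close> the value does not matter.\<close>
  define N where "N = Suc (Max (?s ` F))"
  have N: "?s m < N" if "m \<in> F" for m
    unfolding N_def less_Suc_eq_le using that assms(2) by (intro Max_ge) auto
  have eq: "(\<Sum>i\<in>insert j J. (a(j := N)) i * m i) = N * m j + ?s m" for m
  proof -
    have "(\<Sum>i\<in>J. (a(j := N)) i * m i) = ?s m"
      by (rule sum.cong) (use insert in auto)
    then show ?thesis using insert by simp
  qed
  show ?case
  proof (intro exI[of _ "a(j := N)"] ballI impI)
    fix m m' i
    assume m: "m \<in> F" "m' \<in> F" and i: "i \<in> insert j J"
      and "(\<Sum>i\<in>insert j J. (a(j := N)) i * m i) = (\<Sum>i\<in>insert j J. (a(j := N)) i * m' i)"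
    then have e: "N * m j + ?s m = N * m' j + ?s m'" unfolding eq by simp
    have "(N * m j + ?s m) div N = m j" "(N * m' j + ?s m') div N = m' j"
      using N[OF m(1)] N[OF m(2)] by auto
    then have "m j = m' j" using e by simp
    with e a[OF m] i show "m i = m' i" by auto
  qed
qed

text \<open>Kronecker substitution: \<open>x\<^sub>i = t ^ a\<^sub>i\<close> with weights separating the monomials
  of \<open>p\<close> reduces to one variable.\<close>

lemma eval_mpoly_nonzero:
  fixes p :: "'n::finite real_mpoly"
  assumes "p \<noteq> 0"
  shows "\<exists>v. eval_mpoly p v \<noteq> 0"
proof -
  let ?K = "Poly_Mapping.keys p"
  obtain a :: "'n \<Rightarrow> nat" where a: "\<forall>m\<in>Poly_Mapping.lookup ` ?K. \<forall>m'\<in>Poly_Mapping.lookup ` ?K.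
     (\<Sum>i\<in>UNIV. a i * m i) = (\<Sum>i\<in>UNIV. a i * m' i) \<longrightarrow> (\<forall>i\<in>UNIV. m i = m' i)"
    using separating_weights[OF finite[of UNIV] finite_imageI[OF finite_keys[of p], of Poly_Mapping.lookup]]
    by (elim exE) (rule that)
  define w where "w m = (\<Sum>i\<in>UNIV. a i * Poly_Mapping.lookup m i)" for m
  have inj: "m = m'" if "m \<in> ?K" "m' \<in> ?K" "w m = w m'" for m m'
  proof (rule poly_mapping_eqI)
    show "Poly_Mapping.lookup m i = Poly_Mapping.lookup m' i" for i
      using a[rule_format, OF imageI imageI, OF that(1,2)] that(3) unfolding w_def by simp
  qed
  define q where "q = (\<Sum>m\<in>?K. monom (Poly_Mapping.lookup p m) (w m))"
  have q: "poly q t = eval_mpoly p (\<chi> i. t ^ a i)" for t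
    by (simp add: q_def poly_sum poly_monom eval_mpoly_def w_def power_sum power_mult)
  obtain m where m: "m \<in> ?K"
    using assms by (metis equals0I in_keys_iff lookup_zero poly_mapping_eqI)
  \<comment> \<open>Distinct monomials of \<open>p\<close> have distinct degrees under
    \<open>w\<close>, so no coefficients cancel.\<close>
  have "coeff q (w m) = (\<Sum>k\<in>?K. if k = m then Poly_Mapping.lookup p k else 0)"
    unfolding q_def coeff_sum by (rule sum.cong) (use inj m in auto)
  also have "\<dots> = Poly_Mapping.lookup p m" using m by simp
  finally have "q \<noteq> 0" using m by (auto simp: in_keys_iff)
  then have "finite {t. poly q t = 0}" by (rule poly_roots_finite)
  then obtain t where "poly q t \<noteq> 0"
    by (metis (mono_tags, lifting) infinite_UNIV_char_0 mem_Collect_eq UNIV_I finite_subset subsetI)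
  then show ?thesis unfolding q by blast
qed

text \<open>Couples a polynomial, seen in the function field, with its evaluation function. Only
  polynomial elements occur, so no denominator is ever evaluated, and closure rules carry the
  relation through determinants and matrix products.\<close>

definition specializes :: "('n::{finite,linorder}) real_ratfun \<Rightarrow> (real ^ ('n::{finite,linorder}) \<Rightarrow> real) \<Rightarrow> bool" where
  "specializes k f \<longleftrightarrow> (\<exists>P. k = to_fract P \<and> f = eval_mpoly P)"

lemma specializesI:
  "k = to_fract P \<Longrightarrow> (\<And>v. f v = eval_mpoly P v) \<Longrightarrow> specializes k f"
  unfolding specializes_def by (intro exI[of _ P] conjI ext)

lemma specializesE:
  assumes "specializes k f"
  obtains P where "k = to_fract P" "f = eval_mpoly P"
  using assms unfolding specializes_def by (elim exE conjE) (rule that)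

lemma specializes_0: "specializes 0 (\<lambda>v. 0)"
  by (rule specializesI[of _ 0]) simp_all

lemma specializes_const: "specializes (ratfun_const c) (\<lambda>v. c)"
  by (rule specializesI[OF ratfun_const_def]) (simp add: eval_mpoly_single)

lemma specializes_1: "specializes 1 (\<lambda>v. 1)"
  using specializes_const[of 1] by (simp add: ratfun_const_def)

lemma specializes_var: "specializes (ratfun_var i) (\<lambda>v. v $ i)"
proof (rule specializesI[OF ratfun_var_def])
  fix v :: "real ^ ('a::{finite,linorder})"
  have "(\<Prod>j\<in>UNIV. (v $ j) ^ Poly_Mapping.lookup (Poly_Mapping.single i 1) j)
      = (\<Prod>j\<in>UNIV. if j = i then v $ j else 1)"
    by (rule prod.cong) (simp_all add: lookup_single when_def)
  then show "v $ i = eval_mpoly (Poly_Mapping.single (Poly_Mapping.single i 1) 1) v"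
    by (simp add: eval_mpoly_single)
qed

lemma specializes_add:
  assumes "specializes k f" "specializes l g"
  shows "specializes (k + l) (\<lambda>v. f v + g v)"
proof -
  obtain P Q where "k = to_fract P" "f = eval_mpoly P" "l = to_fract Q" "g = eval_mpoly Q"
    using assms by (elim specializesE)
  then show ?thesis
    by (intro specializesI[of _ "P + Q"]) (simp_all add: eval_mpoly_add)
qed

lemma specializes_mult:
  assumes "specializes k f" "specializes l g"
  shows "specializes (k * l) (\<lambda>v. f v * g v)"
proof -
  obtain P Q where "k = to_fract P" "f = eval_mpoly P" "l = to_fract Q" "g = eval_mpoly Q"
    using assms by (elim specializesE)
  then show ?thesis
    by (intro specializesI[of _ "P * Q"]) (simp_all add: eval_mpoly_mult)
qed

lemma specializes_uminus:
  assumes "specializes k f"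
  shows "specializes (- k) (\<lambda>v. - f v)"
proof -
  obtain P where "k = to_fract P" "f = eval_mpoly P"
    using assms by (elim specializesE)
  then show ?thesis
    by (intro specializesI[of _ "- P"]) (simp_all add: eval_mpoly_uminus)
qed

lemma specializes_diff: "specializes k f \<Longrightarrow> specializes l g \<Longrightarrow> specializes (k - l) (\<lambda>v. f v - g v)"
  using specializes_add[of k f "- l" "\<lambda>v. - g v"] specializes_uminus[of l g] by simp

lemma specializes_sum:
  "(\<And>i. i \<in> I \<Longrightarrow> specializes (k i) (f i)) \<Longrightarrow> specializes (\<Sum>i\<in>I. k i) (\<lambda>v. \<Sum>i\<in>I. f i v)"
  by (induction I rule: infinite_finite_induct) (auto intro: specializes_0 specializes_add)

lemma specializes_prod:
  "(\<And>i. i \<in> I \<Longrightarrow> specializes (k i) (f i)) \<Longrightarrow> specializes (\<Prod>i\<in>I. k i) (\<lambda>v. \<Prod>i\<in>I. f i v)"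
  by (induction I rule: infinite_finite_induct) (auto intro: specializes_1 specializes_mult)

text \<open>Covers the permutation signs in the Leibniz formula for \<open>det\<close>.\<close>

lemma specializes_of_int: "specializes (of_int z) (\<lambda>v. of_int z)"
proof (induction z rule: int_induct[of _ 0])
  case base
  then show ?case using specializes_0 by simp
next
  case (step1 i)
  then show ?case using specializes_add[OF step1.IH specializes_1] by simp
next
  case (step2 i)
  then show ?case using specializes_diff[OF step2.IH specializes_1] by simp
qed

lemma specializes_det:
  assumes "\<And>i j. specializes (A $ i $ j) (\<lambda>v. B v $ i $ j)"
  shows "specializes (det A) (\<lambda>v. det (B v))"
  unfolding det_def
  by (intro specializes_sum specializes_mult specializes_of_int specializes_prod assms)

lemma specializes_matrix_vector:
  assumes "\<And>i j. specializes (A $ i $ j) (\<lambda>v. B v $ i $ j)" "\<And>j. specializes (x $ j) (\<lambda>v. y v $ j)"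
  shows "specializes ((A *v x) $ i) (\<lambda>v. (B v *v y v) $ i)"
  unfolding matrix_vector_mult_def vec_lambda_beta
  by (intro specializes_sum specializes_mult assms)

lemma specializes_matrix_mult:
  assumes "\<And>i j. specializes (A $ i $ j) (\<lambda>v. B v $ i $ j)" "\<And>i j. specializes (A' $ i $ j) (\<lambda>v. B' v $ i $ j)"
  shows "specializes ((A ** A') $ i $ j) (\<lambda>v. (B v ** B' v) $ i $ j)"
  unfolding matrix_matrix_mult_def vec_lambda_beta
  by (intro specializes_sum specializes_mult assms)

text \<open>A non-zero polynomial has a non-zero value. This is the bridge between identities over
  the function field and identities at all real points.\<close>

lemma specializes_eq_0_iff: "specializes k f \<Longrightarrow> k = 0 \<longleftrightarrow> (\<forall>v. f v = 0)"
  by (elim specializesE) (use eval_mpoly_nonzero in auto)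

text \<open>Stated by basic neighbourhoods, each the non-vanishing set of one polynomial.\<close>

definition zariski_open :: "(real ^ ('n::{finite,linorder})) set \<Rightarrow> bool" where
  "zariski_open U \<longleftrightarrow> (\<forall>v\<in>U. \<exists>p. eval_mpoly p v \<noteq> 0 \<and> {w. eval_mpoly p w \<noteq> 0} \<subseteq> U)"

lemma zariski_open_basic: "specializes k f \<Longrightarrow> zariski_open {v. f v \<noteq> 0}"
  by (elim specializesE) (auto simp: zariski_open_def)

lemma zariski_open_UN:
  assumes "\<And>i. i \<in> I \<Longrightarrow> zariski_open (U i)"
  shows "zariski_open (\<Union>i\<in>I. U i)"
  unfolding zariski_open_def
proof
  fix v assume "v \<in> (\<Union>i\<in>I. U i)"
  then obtain i where i: "i \<in> I" "v \<in> U i" by blast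
  then obtain p where "eval_mpoly p v \<noteq> 0" "{w. eval_mpoly p w \<noteq> 0} \<subseteq> U i"
    using assms unfolding zariski_open_def by blast
  then show "\<exists>p. eval_mpoly p v \<noteq> 0 \<and> {w. eval_mpoly p w \<noteq> 0} \<subseteq> (\<Union>i\<in>I. U i)"
    using i by blast
qed

lemma zariski_open_Int:
  assumes "zariski_open U" "zariski_open V"
  shows "zariski_open (U \<inter> V)"
  unfolding zariski_open_def
proof
  fix v assume "v \<in> U \<inter> V"
  then obtain p q where "eval_mpoly p v \<noteq> 0" "{w. eval_mpoly p w \<noteq> 0} \<subseteq> U"
    "eval_mpoly q v \<noteq> 0" "{w. eval_mpoly q w \<noteq> 0} \<subseteq> V"
    using assms unfolding zariski_open_def by blast
  then show "\<exists>p. eval_mpoly p v \<noteq> 0 \<and> {w. eval_mpoly p w \<noteq> 0} \<subseteq> U \<inter> V"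
    by (intro exI[of _ "p * q"]) (auto simp: eval_mpoly_mult)
qed

text \<open>Irreducibility of affine space: the product of two non-zero polynomials is non-zero in
  the domain and hence has a non-zero value.\<close>

lemma zariski_open_Int_nonempty:
  assumes "zariski_open U" "zariski_open V" "U \<noteq> {}" "V \<noteq> {}"
  shows "U \<inter> V \<noteq> {}"
proof -
  obtain p q where p: "p \<noteq> 0" "{w. eval_mpoly p w \<noteq> 0} \<subseteq> U"
    and q: "q \<noteq> 0" "{w. eval_mpoly q w \<noteq> 0} \<subseteq> V"
    using assms unfolding zariski_open_def by (metis all_not_in_conv eval_mpoly_0)
  obtain w where "eval_mpoly (p * q) w \<noteq> 0"
    using eval_mpoly_nonzero[of "p * q"] p q by auto
  then show ?thesis using p q by (auto simp: eval_mpoly_mult)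
qed

lemma zariski_open_INT:
  assumes "finite I" "\<And>i. i \<in> I \<Longrightarrow> zariski_open (U i) \<and> U i \<noteq> {}"
  shows "zariski_open (\<Inter>i\<in>I. U i) \<and> (\<Inter>i\<in>I. U i) \<noteq> {}"
  using assms
proof (induction I)
  case empty
  show ?case using zariski_open_basic[OF specializes_1] by simp
next
  case (insert x F)
  then have "zariski_open (U x)" "U x \<noteq> {}"
    "zariski_open (\<Inter>i\<in>F. U i)" "(\<Inter>i\<in>F. U i) \<noteq> {}"
    by auto
  then show ?case
    unfolding INT_insert by (blast intro: zariski_open_Int dest: zariski_open_Int_nonempty)
qed

text \<open>Take all non-zero polynomials that vanish outside \<open>U\<close>; openness provides,
  for each point of \<open>U\<close>, one that does not vanish there.\<close>

lemma zariski_closed_zeros: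
  fixes U :: "(real ^ ('n::{finite,linorder})) set"
  assumes "zariski_open U" "U \<noteq> {}"
  shows "\<exists>S :: 'n real_mpoly set. S \<noteq> {} \<and> 0 \<notin> S \<and> - U = {v. \<forall>p\<in>S. eval_mpoly p v = 0}"
proof -
  let ?S = "{p. p \<noteq> 0 \<and> {w. eval_mpoly p w \<noteq> 0} \<subseteq> U}"
  have ex: "\<exists>p\<in>?S. eval_mpoly p v \<noteq> 0" if v: "v \<in> U" for v
  proof -
    obtain p where p: "eval_mpoly p v \<noteq> 0" "{w. eval_mpoly p w \<noteq> 0} \<subseteq> U"
      using assms(1) v unfolding zariski_open_def by blast
    then have "p \<noteq> 0" by auto
    with p show ?thesis by blast
  qed
  show ?thesis
  proof (intro exI[of _ ?S] conjI)
    show "?S \<noteq> {}" using assms(2) ex by blast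
    show "- U = {v. \<forall>p\<in>?S. eval_mpoly p v = 0}"
      using ex by fast
  qed simp
qed

section \<open>Linear symmetries via Cramer's rule\<close>

text \<open>The vectors form the rows, so prescribing the images of all \<open>u (b i)\<close> under
  a matrix becomes one linear system for each row of that matrix. A non-zero determinant says that
  \<open>b\<close> selects a basis.\<close>

definition frame :: "('i \<Rightarrow> 'k::field ^ 'n) \<Rightarrow> ('n \<Rightarrow> 'i) \<Rightarrow> 'k ^ 'n ^ 'n" where
  "frame u b = (\<chi> i j. u (b i) $ j)"

text \<open>By Cramer's rule, \<open>cramer_sym u b \<sigma>\<close> is \<open>det (frame u b)\<close> times the matrix that maps
  \<open>u (b i)\<close> to \<open>u (\<sigma> (b i))\<close> for all \<open>i\<close>; unlike that matrix, it is polynomial in \<open>u\<close>.\<close>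

definition cramer_sym :: "('i \<Rightarrow> 'k::field ^ 'n) \<Rightarrow> ('n \<Rightarrow> 'i) \<Rightarrow> ('i \<Rightarrow> 'i) \<Rightarrow> 'k ^ 'n ^ 'n" where
  "cramer_sym u b \<sigma> = (\<chi> r k. det (\<chi> i j. if j = k then u (\<sigma> (b i)) $ r else u (b i) $ j))"

lemma frame_mult_row: "(frame u b *v (A $ r)) $ i = (A *v u (b i)) $ r"
  by (simp add: matrix_vector_mult_def frame_def mult.commute)

lemma cramer_sym:
  fixes u :: "'i \<Rightarrow> 'k::field ^ 'n"
  assumes "det (frame u b) \<noteq> 0"
  shows "(\<forall>i. A *v u (b i) = u (\<sigma> (b i))) \<longleftrightarrow>
    (\<forall>r k. A $ r $ k = cramer_sym u b \<sigma> $ r $ k / det (frame u b))"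
proof -
  have "(\<forall>i. A *v u (b i) = u (\<sigma> (b i))) \<longleftrightarrow>
      (\<forall>r. frame u b *v (A $ r) = (\<chi> i. u (\<sigma> (b i)) $ r))"
    by (auto simp: vec_eq_iff frame_mult_row)
  also have "\<dots> \<longleftrightarrow> (\<forall>r k. A $ r $ k = cramer_sym u b \<sigma> $ r $ k / det (frame u b))"
  proof -
    have "det (\<chi> i j. if j = k then (\<chi> i. u (\<sigma> (b i)) $ r) $ i else frame u b $ i $ j)
        = cramer_sym u b \<sigma> $ r $ k" for r k
      by (simp add: cramer_sym_def frame_def cong: if_cong)
    then show ?thesis
      unfolding cramer[OF assms] by (simp add: vec_eq_iff)
  qed
  finally show ?thesis .
qed

lemma frame_matrix_unique:
  assumes "det (frame u b) \<noteq> 0" "\<And>i. A *v u (b i) = B *v u (b i)"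
  shows "A = B"
proof -
  have "frame u b *v (A $ r) = frame u b *v (B $ r)" for r
    using assms(2) by (simp add: vec_eq_iff frame_mult_row)
  then have "A $ r = B $ r" for r
    by (rule trans[OF iffD1[OF cramer[OF assms(1)]] sym[OF iffD1[OF cramer[OF assms(1)] refl]]])
  then show ?thesis by (simp add: vec_eq_iff)
qed

text \<open>The frame of the images factors as the frame of the preimages times the transpose of
  \<open>A\<close>.\<close>

lemma det_nonzero_frame:
  assumes "det (frame u c) \<noteq> 0" "\<And>i. A *v u (c' i) = u (c i)"
  shows "det A \<noteq> 0"
proof -
  have "frame u c = frame u c' ** transpose A"
    by (simp add: frame_def vec_eq_iff matrix_matrix_mult_def transpose_def
        assms(2)[symmetric] matrix_vector_mult_def mult.commute)
  then show ?thesis using assms(1) by (auto simp: det_mul det_transpose)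
qed

text \<open>The images of the basis selected by \<open>b\<close> determine the only candidate
  matrix, and clearing its denominator leaves relations polynomial in \<open>u\<close>. They make
  sense both over the reals and over the function field.\<close>

lemma LinSym_iff:
  fixes u :: "'i \<Rightarrow> 'k::field ^ 'n"
  assumes d: "det (frame u b) \<noteq> 0" and b: "range b \<subseteq> I" and \<sigma>: "\<sigma> permutes I"
  shows "\<sigma> \<in> LinSym I u \<longleftrightarrow>
    (\<forall>g\<in>I. cramer_sym u b \<sigma> *v u g = det (frame u b) *s u (\<sigma> g))"
proof
  assume "\<sigma> \<in> LinSym I u"
  then obtain A where A: "\<forall>i\<in>I. A *v u i = u (\<sigma> i)" by (auto simp: LinSym_def)
  then have "\<forall>i. A *v u (b i) = u (\<sigma> (b i))" using b by auto
  then have "cramer_sym u b \<sigma> $ r $ k = det (frame u b) * A $ r $ k" for r k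
    using cramer_sym[OF d] d by simp
  then have "cramer_sym u b \<sigma> *v x = det (frame u b) *s (A *v x)" for x
    by (simp add: vec_eq_iff matrix_vector_mult_def sum_distrib_left mult.assoc)
  then show "\<forall>g\<in>I. cramer_sym u b \<sigma> *v u g = det (frame u b) *s u (\<sigma> g)"
    using A by simp
next
  assume *: "\<forall>g\<in>I. cramer_sym u b \<sigma> *v u g = det (frame u b) *s u (\<sigma> g)"
  define A where "A = (\<chi> r k. cramer_sym u b \<sigma> $ r $ k / det (frame u b))"
  have "A *v x = inverse (det (frame u b)) *s (cramer_sym u b \<sigma> *v x)" for x
    by (simp add: A_def vec_eq_iff matrix_vector_mult_def sum_distrib_left field_simps)
  then have A: "\<forall>g\<in>I. A *v u g = u (\<sigma> g)" using * d by (simp add: vec_eq_iff)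
  have "det A \<noteq> 0"
  proof (rule det_nonzero_frame[OF d])
    fix i
    \<comment> \<open>Invertibility of \<open>A\<close>: it maps the vectors at the preimages of the
      basis indices onto the basis.\<close>
    have "inv_into UNIV \<sigma> (b i) \<in> I" using b permutes_in_image[OF permutes_inv[OF \<sigma>]] by auto
    then show "A *v u (inv_into UNIV \<sigma> (b i)) = u (b i)"
      using A permutes_inverses(1)[OF \<sigma>] by simp
  qed
  then show "\<sigma> \<in> LinSym I u"
    using A \<sigma> by (auto simp: LinSym_def GL_def invertible_det_nz)
qed

section \<open>Bases inside real spanning families\<close>

lemma frame_span:
  fixes u :: "'i \<Rightarrow> real ^ 'n"
  shows "det (frame u b) \<noteq> 0 \<longleftrightarrow> span (range (u \<circ> b)) = UNIV"
proof -
  have "rows (frame u b) = range (u \<circ> b)"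
    by (auto simp: rows_def row_def frame_def image_def vec_lambda_eta)
  then show ?thesis
    by (metis invertible_det_nz invertible_left_inverse matrix_left_invertible_span_rows)
qed

lemma span_frame:
  fixes u :: "'i \<Rightarrow> real ^ 'n"
  assumes "det (frame u b) \<noteq> 0" "range b \<subseteq> I"
  shows "span (u ` I) = UNIV"
proof -
  have "range (u \<circ> b) \<subseteq> u ` I" using assms(2) by auto
  from span_mono[OF this] show ?thesis using assms(1) unfolding frame_span by auto
qed

lemma exists_frame:
  fixes u :: "'i \<Rightarrow> real ^ 'n"
  assumes "span (u ` I) = UNIV"
  obtains b where "det (frame u b) \<noteq> 0" "range b \<subseteq> I"
proof -
  obtain B where B: "B \<subseteq> u ` I" "independent B" "u ` I \<subseteq> span B" "card B = dim (u ` I)"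
    using basis_exists by blast
  have spB: "span B = UNIV"
    using span_mono[OF B(3)] assms by (simp add: span_span top.extremum_unique)
  have "dim (u ` I) = CARD('n)"
    using dim_span[of "u ` I"] assms by simp
  then obtain f :: "'n \<Rightarrow> real ^ 'n" where f: "bij_betw f UNIV B"
    using B(2,4) finiteI_independent[OF B(2)] by (metis finite finite_same_card_bij)
  have fI: "f i \<in> u ` I" for i using f B(1) by (auto simp: bij_betw_def)
  define b where "b i = inv_into I u (f i)" for i
  have "u \<circ> b = f" using fI by (auto simp: b_def f_inv_into_f)
  then have "det (frame u b) \<noteq> 0" unfolding frame_span using f spB by (simp add: bij_betw_def)
  moreover have "range b \<subseteq> I" using fI by (auto simp: b_def inv_into_into)
  ultimately show ?thesis by (rule that)
qed

section \<open>Specialization from the generic orbit to real orbits\<close>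

abbreviation orbit_map :: "real ^ 'n \<Rightarrow> real ^ 'n ^ 'n \<Rightarrow> real ^ 'n" where
  "orbit_map v \<equiv> (\<lambda>g. g *v v)"

abbreviation generic_orbit_map ::
    "real ^ ('n::{finite,linorder}) ^ ('n::{finite,linorder}) \<Rightarrow> 'n real_ratfun ^ ('n::{finite,linorder})" where
  "generic_orbit_map \<equiv> (\<lambda>g. ratfun_matrix g *v generic_vector)"

lemma specializes_orbit:
  "specializes (generic_orbit_map g $ i) (\<lambda>v. orbit_map v g $ i)"
  by (rule specializes_matrix_vector)
     (simp_all add: ratfun_matrix_def generic_vector_def specializes_const specializes_var)

lemma specializes_frame:
  "specializes (det (frame generic_orbit_map b)) (\<lambda>v. det (frame (orbit_map v) b))"
  by (rule specializes_det) (simp add: frame_def specializes_orbit)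

lemma specializes_cramer_sym:
  "specializes (cramer_sym generic_orbit_map b \<sigma> $ r $ k) (\<lambda>v. cramer_sym (orbit_map v) b \<sigma> $ r $ k)"
  unfolding cramer_sym_def vec_lambda_beta
  by (rule specializes_det) (simp add: specializes_orbit)

text \<open>The difference of the two sides in \<open>LinSym_iff\<close>, so that failure to be a
  linear symmetry becomes non-vanishing of a polynomial.\<close>

lemma specializes_defect:
  "specializes
    ((cramer_sym generic_orbit_map b \<sigma> *v generic_orbit_map g
       - det (frame generic_orbit_map b) *s generic_orbit_map (\<sigma> g)) $ i)
    (\<lambda>v. (cramer_sym (orbit_map v) b \<sigma> *v orbit_map v g
       - det (frame (orbit_map v) b) *s orbit_map v (\<sigma> g)) $ i)"
  unfolding vector_minus_component vector_smult_component
  by (intro specializes_diff specializes_mult specializes_matrix_vector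
      specializes_cramer_sym specializes_frame specializes_orbit)

text \<open>A frame for the orbit of \<open>v\<close> is also one for the generic orbit, since its
  determinant specializes to a non-zero number. The defects in this frame vanish over the function
  field and therefore at \<open>v\<close>.\<close>

lemma LinSym_generic_subset:
  assumes "span (orbit_map v ` G) = UNIV"
  shows "LinSym G generic_orbit_map \<subseteq> LinSym G (orbit_map v)"
proof
  fix \<sigma> assume \<sigma>: "\<sigma> \<in> LinSym G generic_orbit_map"
  then have perm: "\<sigma> permutes G" by (simp add: LinSym_def)
  obtain b where b: "det (frame (orbit_map v) b) \<noteq> 0" "range b \<subseteq> G"
    using exists_frame[OF assms] .
  have d: "det (frame generic_orbit_map b) \<noteq> 0"
    using specializes_eq_0_iff[OF specializes_frame] b(1) by blast
  show "\<sigma> \<in> LinSym G (orbit_map v)"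
    unfolding LinSym_iff[OF b perm]
  proof
    fix g assume "g \<in> G"
    then have "cramer_sym generic_orbit_map b \<sigma> *v generic_orbit_map g
       - det (frame generic_orbit_map b) *s generic_orbit_map (\<sigma> g) = 0"
      using \<sigma> LinSym_iff[OF d b(2) perm] by simp
    then have "(cramer_sym (orbit_map v) b \<sigma> *v orbit_map v g
       - det (frame (orbit_map v) b) *s orbit_map v (\<sigma> g)) $ i = 0" for i
      using specializes_eq_0_iff[OF specializes_defect[of b \<sigma> g i]] by simp
    then show "cramer_sym (orbit_map v) b \<sigma> *v orbit_map v g = det (frame (orbit_map v) b) *s orbit_map v (\<sigma> g)"
      by (simp add: vec_eq_iff)
  qed
qed

text \<open>Spanning means that some frame determinant is non-zero.\<close>

lemma zariski_open_spanning: "zariski_open {v. span (orbit_map v ` G) = UNIV}"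
proof -
  have "{v. span (orbit_map v ` G) = UNIV} = (\<Union>b\<in>{b. range b \<subseteq> G}. {v. det (frame (orbit_map v) b) \<noteq> 0})"
    using span_frame exists_frame by (fastforce elim: exists_frame)
  then show ?thesis
    by (simp add: zariski_open_UN zariski_open_basic[OF specializes_frame])
qed

text \<open>A permutation that is not a linear symmetry of the generic orbit violates one of the
  Cramer relations over \<open>\<real>(X)\<close>, which then fails on a non-empty Zariski-open set.\<close>

lemma zariski_open_not_LinSym:
  assumes "\<sigma> permutes G"
  shows "zariski_open {v. span (orbit_map v ` G) = UNIV \<and> \<sigma> \<notin> LinSym G (orbit_map v)}"
proof -
  let ?D = "\<lambda>v b g i. (cramer_sym (orbit_map v) b \<sigma> *v orbit_map v g
       - det (frame (orbit_map v) b) *s orbit_map v (\<sigma> g)) $ i"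
  let ?U = "{v. span (orbit_map v ` G) = UNIV \<and> \<sigma> \<notin> LinSym G (orbit_map v)}"
  let ?V = "\<Union>b\<in>{b. range b \<subseteq> G}. \<Union>g\<in>G. \<Union>i. {v. det (frame (orbit_map v) b) \<noteq> 0} \<inter> {v. ?D v b g i \<noteq> 0}"
  have UV: "?U \<subseteq> ?V"
  proof
    fix v assume "v \<in> ?U"
    then obtain b where b: "det (frame (orbit_map v) b) \<noteq> 0" "range b \<subseteq> G"
      using exists_frame by blast
    then obtain g i where "g \<in> G" "?D v b g i \<noteq> 0"
      using \<open>v \<in> ?U\<close> LinSym_iff[OF b assms] by (auto simp: vec_eq_iff)
    with b show "v \<in> ?V" by blast
  qed
  have VU: "?V \<subseteq> ?U"
  proof
    fix v assume "v \<in> ?V"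
    then obtain b g i where b: "range b \<subseteq> G" "det (frame (orbit_map v) b) \<noteq> 0"
      and g: "g \<in> G" "?D v b g i \<noteq> 0" by blast
    then have "\<sigma> \<notin> LinSym G (orbit_map v)"
      using LinSym_iff[OF b(2,1) assms] by auto
    then show "v \<in> ?U" using span_frame[OF b(2,1)] by blast
  qed
  have "zariski_open ?V"
    by (intro zariski_open_UN zariski_open_Int zariski_open_basic[OF specializes_frame]
        zariski_open_basic[OF specializes_defect])
  then show ?thesis by (simp only: equalityI[OF UV VU])
qed

text \<open>The point \<open>v\<close> only supplies a frame. Over the function field its
  determinant times a non-zero defect is non-zero, so some \<open>w\<close> keeps both factors
  non-zero at once.\<close>

lemma not_LinSym_nonempty:
  assumes perm: "\<sigma> permutes G" and "\<sigma> \<notin> LinSym G generic_orbit_map"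
    and "span (orbit_map v ` G) = UNIV"
  shows "\<exists>w. span (orbit_map w ` G) = UNIV \<and> \<sigma> \<notin> LinSym G (orbit_map w)"
proof -
  obtain b where b: "det (frame (orbit_map v) b) \<noteq> 0" "range b \<subseteq> G"
    using exists_frame[OF assms(3)] .
  have d: "det (frame generic_orbit_map b) \<noteq> 0"
    using specializes_eq_0_iff[OF specializes_frame] b(1) by blast
  obtain g i where g: "g \<in> G" "(cramer_sym generic_orbit_map b \<sigma> *v generic_orbit_map g
       - det (frame generic_orbit_map b) *s generic_orbit_map (\<sigma> g)) $ i \<noteq> 0" (is "?d \<noteq> 0")
    using LinSym_iff[OF d b(2) perm] assms(2) by (auto simp: vec_eq_iff)
  have "det (frame generic_orbit_map b) * ?d \<noteq> 0" using d g by simp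
  then obtain w where w: "det (frame (orbit_map w) b) \<noteq> 0"
     "(cramer_sym (orbit_map w) b \<sigma> *v orbit_map w g
       - det (frame (orbit_map w) b) *s orbit_map w (\<sigma> g)) $ i \<noteq> 0"
    using specializes_eq_0_iff[OF specializes_mult[OF specializes_frame[of b] specializes_defect[of b \<sigma> g i]]]
    by auto
  then have "\<sigma> \<notin> LinSym G (orbit_map w)"
    using LinSym_iff[OF w(1) b(2) perm] g(1) by auto
  then show ?thesis using span_frame[OF w(1) b(2)] by blast
qed

section \<open>Equivalence of the representations on different orbits\<close>

lemma GL_inv:
  fixes M :: "'k::field ^ 'n ^ 'n"
  assumes "invertible M"
  shows "M ** inv\<^bsub>GL\<^esub> M = mat 1" "inv\<^bsub>GL\<^esub> M ** M = mat 1" "invertible (inv\<^bsub>GL\<^esub> M)"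
  using group.r_inv[OF group_GL, of M] group.l_inv[OF group_GL, of M]
    group.inv_closed[OF group_GL, of M] assms
  by (simp_all add: GL_def)

lemma sum_matrix_mult_right:
  fixes B :: "'k::comm_semiring_1 ^ 'n ^ 'm"
  shows "(\<Sum>i\<in>I. A i) ** B = (\<Sum>i\<in>I. A i ** B)"
  by (auto simp: vec_eq_iff matrix_matrix_mult_def sum_component sum_distrib_right intro: sum.swap)

lemma sum_matrix_mult_left:
  fixes B :: "'k::comm_semiring_1 ^ 'n ^ 'm"
  shows "B ** (\<Sum>i\<in>I. A i) = (\<Sum>i\<in>I. B ** A i)"
  by (auto simp: vec_eq_iff matrix_matrix_mult_def sum_component sum_distrib_left intro: sum.swap)

lemma sum_matrix_vector:
  fixes x :: "'k::comm_semiring_1 ^ 'n"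
  shows "(\<Sum>i\<in>I. A i) *v x = (\<Sum>i\<in>I. A i *v x)"
  by (induction I rule: infinite_finite_induct) (simp_all add: matrix_vector_mult_add_rdistrib)

text \<open>Meaningful for \<sigma> in \<open>LinSym I u\<close>; for a real spanning family the
  choice is then unique, by \<open>spanning_matrix_unique\<close>.\<close>

definition sym_matrix :: "'i set \<Rightarrow> ('i \<Rightarrow> 'k::field ^ 'n) \<Rightarrow> ('i \<Rightarrow> 'i) \<Rightarrow> 'k ^ 'n ^ 'n" where
  "sym_matrix I u \<sigma> = (SOME A. A \<in> carrier GL \<and> (\<forall>i\<in>I. A *v u i = u (\<sigma> i)))"

lemma sym_matrix:
  assumes "\<sigma> \<in> LinSym I u"
  shows "invertible (sym_matrix I u \<sigma>)" "i \<in> I \<Longrightarrow> sym_matrix I u \<sigma> *v u i = u (\<sigma> i)"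
proof -
  have "\<exists>A. A \<in> carrier GL \<and> (\<forall>i\<in>I. A *v u i = u (\<sigma> i))"
    using assms unfolding LinSym_def by blast
  from someI_ex[OF this] show "invertible (sym_matrix I u \<sigma>)" "i \<in> I \<Longrightarrow> sym_matrix I u \<sigma> *v u i = u (\<sigma> i)"
    unfolding sym_matrix_def[symmetric] by (simp_all add: GL_def)
qed

lemma spanning_matrix_unique:
  fixes u :: "'i \<Rightarrow> real ^ 'n"
  assumes "span (u ` I) = UNIV" "\<And>i. i \<in> I \<Longrightarrow> A *v u i = B *v u i"
  shows "A = B"
proof -
  obtain b where b: "det (frame u b) \<noteq> 0" "range b \<subseteq> I"
    using exists_frame[OF assms(1)] .
  show ?thesis by (rule frame_matrix_unique[OF b(1)]) (use b(2) assms(2) in blast)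
qed

lemma LinSym_comp:
  assumes "\<sigma> \<in> LinSym I u" "\<tau> \<in> LinSym I u"
  shows "\<sigma> \<circ> \<tau> \<in> LinSym I u"
proof -
  have p: "\<sigma> permutes I" "\<tau> permutes I" using assms by (auto simp: LinSym_def)
  let ?A = "sym_matrix I u \<sigma> ** sym_matrix I u \<tau>"
  have "?A \<in> carrier GL" using sym_matrix(1)[OF assms(1)] sym_matrix(1)[OF assms(2)]
    by (simp add: GL_def invertible_mult)
  moreover have "?A *v u i = u ((\<sigma> \<circ> \<tau>) i)" if "i \<in> I" for i
    using that sym_matrix(2)[OF assms(1)] sym_matrix(2)[OF assms(2)] permutes_in_image[OF p(2)]
    by (simp add: matrix_vector_mul_assoc[symmetric])
  ultimately show ?thesis using permutes_compose[OF p(2,1)] by (auto simp: LinSym_def)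
qed

lemma sym_matrix_comp:
  fixes u :: "'i \<Rightarrow> real ^ 'n"
  assumes "span (u ` I) = UNIV" "\<sigma> \<in> LinSym I u" "\<tau> \<in> LinSym I u"
  shows "sym_matrix I u (\<sigma> \<circ> \<tau>) = sym_matrix I u \<sigma> ** sym_matrix I u \<tau>"
proof (rule spanning_matrix_unique[OF assms(1)])
  fix i assume i: "i \<in> I"
  have "\<tau> i \<in> I" using i permutes_in_image assms(3) by (fastforce simp: LinSym_def)
  then show "sym_matrix I u (\<sigma> \<circ> \<tau>) *v u i = sym_matrix I u \<sigma> ** sym_matrix I u \<tau> *v u i"
    using i sym_matrix(2)[OF LinSym_comp[OF assms(2,3)]] sym_matrix(2)[OF assms(2)] sym_matrix(2)[OF assms(3)]
    by (simp add: matrix_vector_mul_assoc[symmetric])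
qed

text \<open>Exhibits the representing matrix as a polynomial expression in \<open>u\<close> divided
  by a single determinant.\<close>

lemma cramer_sym_eq:
  assumes d: "det (frame u b) \<noteq> 0" and b: "range b \<subseteq> I" and "\<sigma> \<in> LinSym I u"
  shows "cramer_sym u b \<sigma> $ r $ k = det (frame u b) * sym_matrix I u \<sigma> $ r $ k"
proof -
  have "\<forall>i. sym_matrix I u \<sigma> *v u (b i) = u (\<sigma> (b i))"
    using sym_matrix(2)[OF assms(3)] b by auto
  then show ?thesis using cramer_sym[OF d] d by simp
qed

text \<open>The averaging operator from Maschke's theorem applied to the identity matrix, without
  the factor \<open>1 / card H\<close>.\<close>

definition intertwiner :: "('i \<Rightarrow> 'i) set \<Rightarrow> 'i set \<Rightarrow> ('i \<Rightarrow> real ^ 'n) \<Rightarrow> ('i \<Rightarrow> real ^ 'n) \<Rightarrow> real ^ 'n ^ 'n" where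
  "intertwiner H I u u' = (\<Sum>\<sigma>\<in>H. sym_matrix I u \<sigma> ** inv\<^bsub>GL\<^esub> (sym_matrix I u' \<sigma>))"

lemma intertwiner:
  fixes u u' :: "'i \<Rightarrow> real ^ 'n"
  assumes H: "finite H" "H \<subseteq> LinSym I u" "H \<subseteq> LinSym I u'"
    and comp: "\<And>\<sigma> \<tau>. \<sigma> \<in> H \<Longrightarrow> \<tau> \<in> H \<Longrightarrow> \<sigma> \<circ> \<tau> \<in> H"
    and span: "span (u ` I) = UNIV" "span (u' ` I) = UNIV"
    and \<tau>: "\<tau> \<in> H"
  shows "sym_matrix I u \<tau> ** intertwiner H I u u' = intertwiner H I u u' ** sym_matrix I u' \<tau>"
proof -
  let ?S = "sym_matrix I u" and ?S' = "sym_matrix I u'"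
  have inj: "inj_on (\<lambda>\<sigma>. \<tau> \<circ> \<sigma>) H"
  proof (rule inj_onI)
    fix \<sigma> \<rho> assume "\<tau> \<circ> \<sigma> = \<tau> \<circ> \<rho>"
    moreover have "inj \<tau>" using \<tau> H(2) permutes_inj by (fastforce simp: LinSym_def)
    ultimately show "\<sigma> = \<rho>" by (simp add: fun.inj_map_strong inj_on_def fun_eq_iff)
  qed
  \<comment> \<open>Left translation by \<tau> is an injective self-map of a finite set, hence
    permutes \<open>H\<close>; reindexing along it moves \<tau> past the sum.\<close>
  have img: "(\<lambda>\<sigma>. \<tau> \<circ> \<sigma>) ` H = H"
    by (rule endo_inj_surj[OF H(1) _ inj]) (use comp \<tau> in auto)
  have step: "?S \<tau> ** (?S \<sigma> ** inv\<^bsub>GL\<^esub> (?S' \<sigma>)) = ?S (\<tau> \<circ> \<sigma>) ** inv\<^bsub>GL\<^esub> (?S' (\<tau> \<circ> \<sigma>)) ** ?S' \<tau>"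
    if \<sigma>: "\<sigma> \<in> H" for \<sigma>
  proof -
    let ?C = "?S' (\<tau> \<circ> \<sigma>)"
    have inv: "invertible (?S' \<sigma>)" "invertible ?C"
      using \<sigma> \<tau> comp H(3) sym_matrix(1) by blast+
    have "?C ** inv\<^bsub>GL\<^esub> (?S' \<sigma>) = ?S' \<tau>"
      using sym_matrix_comp[OF span(2), of \<tau> \<sigma>] \<sigma> \<tau> H(3) GL_inv(1)[OF inv(1)]
      by (simp add: subset_iff matrix_mul_assoc[symmetric])
    then have "inv\<^bsub>GL\<^esub> ?C ** ?S' \<tau> = inv\<^bsub>GL\<^esub> ?C ** ?C ** inv\<^bsub>GL\<^esub> (?S' \<sigma>)"
      by (simp add: matrix_mul_assoc[symmetric])
    then have "inv\<^bsub>GL\<^esub> ?C ** ?S' \<tau> = inv\<^bsub>GL\<^esub> (?S' \<sigma>)"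
      by (simp add: GL_inv(2)[OF inv(2)])
    moreover have "?S (\<tau> \<circ> \<sigma>) = ?S \<tau> ** ?S \<sigma>"
      using sym_matrix_comp[OF span(1), of \<tau> \<sigma>] \<sigma> \<tau> H(2) by blast
    ultimately show ?thesis by (simp add: matrix_mul_assoc[symmetric])
  qed
  have "?S \<tau> ** intertwiner H I u u' = (\<Sum>\<sigma>\<in>H. ?S (\<tau> \<circ> \<sigma>) ** inv\<^bsub>GL\<^esub> (?S' (\<tau> \<circ> \<sigma>)) ** ?S' \<tau>)"
    unfolding intertwiner_def sum_matrix_mult_left by (rule sum.cong) (use step in auto)
  also have "\<dots> = (\<Sum>\<sigma>\<in>(\<lambda>\<sigma>. \<tau> \<circ> \<sigma>) ` H. ?S \<sigma> ** inv\<^bsub>GL\<^esub> (?S' \<sigma>) ** ?S' \<tau>)"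
    by (simp add: sum.reindex[OF inj])
  also have "\<dots> = intertwiner H I u u' ** ?S' \<tau>"
    unfolding img intertwiner_def sum_matrix_mult_right ..
  finally show ?thesis .
qed

lemma intertwiner_self:
  assumes "H \<subseteq> LinSym I u"
  shows "intertwiner H I u u = real (card H) *\<^sub>R mat 1"
proof -
  have "intertwiner H I u u = (\<Sum>\<sigma>\<in>H. mat 1)"
    unfolding intertwiner_def
    by (rule sum.cong) (use assms GL_inv(1) sym_matrix(1) in blast)+
  then show ?thesis by (simp only: sum_constant_scaleR)
qed

lemma invertible_scaleR:
  fixes A :: "real ^ 'n ^ 'n"
  assumes "c \<noteq> 0"
  shows "invertible (c *\<^sub>R A) \<longleftrightarrow> invertible A"
proof -
  have "invertible (c *\<^sub>R A)" if A: "invertible A" and c: "c \<noteq> 0" for A :: "real ^ 'n ^ 'n" and c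
  proof -
    obtain B where B: "A ** B = mat 1" "B ** A = mat 1" using A by (auto simp: invertible_def)
    then have "(c *\<^sub>R A) ** (inverse c *\<^sub>R B) = mat 1" "(inverse c *\<^sub>R B) ** (c *\<^sub>R A) = mat 1"
      using c by (simp_all add: matrix_scalar_ac scalar_matrix_assoc[symmetric])
    then show ?thesis by (auto simp: invertible_def)
  qed
  from this[of A c] this[of "c *\<^sub>R A" "inverse c"] assms show ?thesis by auto
qed

text \<open>By averaging, a neighbourhood of \<open>w\<close> carries representations equivalent to the one at \<open>w\<close>:
  the determinant of the intertwiner between the representations at \<open>x\<close> and \<open>w\<close> is, up to a power
  of a frame determinant, polynomial in \<open>x\<close>, and it is not zero at \<open>x = w\<close>.\<close>

lemma zariski_open_intertwiner:
  fixes w :: "real ^ ('n::{finite,linorder})"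
  assumes fin: "finite G" and span: "span (orbit_map w ` G) = UNIV"
  defines "H \<equiv> LinSym G generic_orbit_map"
  shows "\<exists>U. zariski_open U \<and> w \<in> U \<and> (\<forall>x\<in>U. span (orbit_map x ` G) = UNIV \<and>
      invertible (intertwiner H G (orbit_map x) (orbit_map w)))"
proof -
  obtain b where b: "det (frame (orbit_map w) b) \<noteq> 0" "range b \<subseteq> G"
    using exists_frame[OF span] .
  have finH: "finite H"
    by (rule finite_subset[OF _ finite_permutations[OF fin]]) (auto simp: H_def LinSym_def)
  have Hx: "H \<subseteq> LinSym G (orbit_map x)" if "span (orbit_map x ` G) = UNIV" for x
    unfolding H_def by (rule LinSym_generic_subset[OF that])
  define N where "N \<sigma> = inv\<^bsub>GL\<^esub> (sym_matrix G (orbit_map w) \<sigma>)" for \<sigma>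
  \<comment> \<open>The intertwiner with its denominator cleared. The inverses
    \<open>N \<sigma>\<close> belong to the fixed point \<open>w\<close> and are constant, so the
    entries of \<open>T x\<close> are polynomial in \<open>x\<close>.\<close>
  define T where "T x = (\<Sum>\<sigma>\<in>H. cramer_sym (orbit_map x) b \<sigma> ** N \<sigma>)" for x
  have T: "T x = det (frame (orbit_map x) b) *\<^sub>R intertwiner H G (orbit_map x) (orbit_map w)"
    if x: "det (frame (orbit_map x) b) \<noteq> 0" for x
  proof -
    have "cramer_sym (orbit_map x) b \<sigma> = det (frame (orbit_map x) b) *\<^sub>R sym_matrix G (orbit_map x) \<sigma>"
      if "\<sigma> \<in> H" for \<sigma>
      using cramer_sym_eq[OF x b(2)] that Hx[OF span_frame[OF x b(2)]] by (auto simp: vec_eq_iff)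
    then show ?thesis
      unfolding T_def intertwiner_def N_def[symmetric] scaleR_sum_right
      by (intro sum.cong) (simp_all add: scalar_matrix_assoc)
  qed
  define U where "U = {x. det (frame (orbit_map x) b) \<noteq> 0} \<inter> {x. det (T x) \<noteq> 0}"
  have "specializes (det (\<Sum>\<sigma>\<in>H. cramer_sym generic_orbit_map b \<sigma> ** ratfun_matrix (N \<sigma>))) (\<lambda>x. det (T x))"
    unfolding T_def
    by (rule specializes_det, unfold sum_component,
        intro specializes_sum specializes_matrix_mult specializes_cramer_sym)
       (simp add: ratfun_matrix_def specializes_const)
  then have "zariski_open U"
    unfolding U_def by (intro zariski_open_Int zariski_open_basic[OF specializes_frame] zariski_open_basic)
  moreover have "w \<in> U"
  proof -
    \<comment> \<open>At \<open>x = w\<close> the intertwiner is \<open>card H\<close> times the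
      identity, so it is invertible once \<open>H\<close> is non-empty.\<close>
    have "id \<in> H" unfolding H_def LinSym_def
      by (auto simp: GL_def permutes_id intro!: bexI[of _ "mat 1"] group.is_monoid[OF group_GL, THEN monoid.one_closed, unfolded GL_def, simplified])
    then have "card H \<noteq> 0" using finH by auto
    moreover have "invertible (mat 1 :: real ^ ('n::{finite,linorder}) ^ ('n::{finite,linorder}))"
      by (simp add: invertible_det_nz)
    ultimately have "invertible (T w)"
      unfolding T[OF b(1)] intertwiner_self[OF Hx[OF span]]
      using b(1) by (simp add: invertible_scaleR)
    then show ?thesis using b(1) by (simp add: U_def invertible_det_nz)
  qed
  moreover have "span (orbit_map x ` G) = UNIV \<and> invertible (intertwiner H G (orbit_map x) (orbit_map w))"
    if "x \<in> U" for x
  proof -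
    have d: "det (frame (orbit_map x) b) \<noteq> 0" and "invertible (T x)"
      using that by (simp_all add: U_def invertible_det_nz)
    then show ?thesis
      unfolding T[OF d] invertible_scaleR[OF d] using span_frame[OF d b(2)] by blast
  qed
  ultimately show ?thesis by blast
qed

text \<open>The detour runs through a point \<open>x\<close> common to the Zariski-open sets
  belonging to \<open>v\<close> and \<open>w\<close>. There both averages are invertible, and
  dividing one by the other gives the equivalence.\<close>

lemma sym_matrices_conjugate:
  fixes v w :: "real ^ ('n::{finite,linorder})"
  assumes fin: "finite G" and v: "span (orbit_map v ` G) = UNIV" and w: "span (orbit_map w ` G) = UNIV"
  defines "H \<equiv> LinSym G generic_orbit_map"
  obtains T where "invertible T"
    "\<And>\<sigma>. \<sigma> \<in> H \<Longrightarrow> sym_matrix G (orbit_map v) \<sigma> ** T = T ** sym_matrix G (orbit_map w) \<sigma>"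
proof -
  obtain U where U: "zariski_open U" "v \<in> U" "\<forall>x\<in>U. span (orbit_map x ` G) = UNIV \<and>
      invertible (intertwiner H G (orbit_map x) (orbit_map v))"
    using zariski_open_intertwiner[OF fin v] unfolding H_def by blast
  obtain V where V: "zariski_open V" "w \<in> V" "\<forall>x\<in>V. span (orbit_map x ` G) = UNIV \<and>
      invertible (intertwiner H G (orbit_map x) (orbit_map w))"
    using zariski_open_intertwiner[OF fin w] unfolding H_def by blast
  obtain x where x: "x \<in> U" "x \<in> V" using zariski_open_Int_nonempty U(1,2) V(1,2) by blast
  have spx: "span (orbit_map x ` G) = UNIV" using U(3) x(1) by blast
  define T1 where "T1 = intertwiner H G (orbit_map x) (orbit_map v)"
  define T2 where "T2 = intertwiner H G (orbit_map x) (orbit_map w)"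
  have finH: "finite H"
    by (rule finite_subset[OF _ finite_permutations[OF fin]]) (auto simp: H_def LinSym_def)
  have Hx: "H \<subseteq> LinSym G (orbit_map x)" if "span (orbit_map x ` G) = UNIV" for x
    unfolding H_def by (rule LinSym_generic_subset[OF that])
  have comp: "\<sigma> \<circ> \<tau> \<in> H" if "\<sigma> \<in> H" "\<tau> \<in> H" for \<sigma> \<tau>
    using LinSym_comp that unfolding H_def by blast
  have T1: "invertible T1" and T2: "invertible T2"
    using U(3) V(3) x by (auto simp: T1_def T2_def)
  show ?thesis
  proof (rule that)
    show "invertible (inv\<^bsub>GL\<^esub> T1 ** T2)" using T1 T2 by (simp add: invertible_mult GL_inv(3))
    fix \<sigma> assume \<sigma>: "\<sigma> \<in> H"
    let ?v = "sym_matrix G (orbit_map v) \<sigma>" and ?w = "sym_matrix G (orbit_map w) \<sigma>"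
      and ?x = "sym_matrix G (orbit_map x) \<sigma>"
    have 1: "?x ** T1 = T1 ** ?v" and 2: "?x ** T2 = T2 ** ?w"
      unfolding T1_def T2_def using intertwiner[OF finH] Hx spx v w comp \<sigma> by blast+
    have "?v ** inv\<^bsub>GL\<^esub> T1 = inv\<^bsub>GL\<^esub> T1 ** (T1 ** ?v) ** inv\<^bsub>GL\<^esub> T1"
      by (simp add: matrix_mul_assoc GL_inv(2)[OF T1])
    also have "\<dots> = inv\<^bsub>GL\<^esub> T1 ** ?x ** (T1 ** inv\<^bsub>GL\<^esub> T1)"
      by (simp add: 1[symmetric] matrix_mul_assoc)
    finally have "?v ** inv\<^bsub>GL\<^esub> T1 = inv\<^bsub>GL\<^esub> T1 ** ?x" by (simp add: GL_inv(1)[OF T1])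
    then have "?v ** (inv\<^bsub>GL\<^esub> T1 ** T2) = inv\<^bsub>GL\<^esub> T1 ** (?x ** T2)"
      by (simp add: matrix_mul_assoc)
    then show "?v ** (inv\<^bsub>GL\<^esub> T1 ** T2) = inv\<^bsub>GL\<^esub> T1 ** T2 ** ?w"
      by (simp add: 2 matrix_mul_assoc)
  qed
qed

lemma conjugate_by_image:
  assumes T: "invertible T" and B: "\<And>\<sigma>. \<sigma> \<in> H \<Longrightarrow> B \<sigma> ** T = T ** C \<sigma>"
  shows "conjugate_by T (C ` H) = B ` H"
proof -
  have "T ** C \<sigma> ** inv\<^bsub>GL\<^esub> T = B \<sigma>" if "\<sigma> \<in> H" for \<sigma>
  proof -
    have "T ** C \<sigma> ** inv\<^bsub>GL\<^esub> T = B \<sigma> ** (T ** inv\<^bsub>GL\<^esub> T)"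
      by (simp add: B[OF that, symmetric] matrix_mul_assoc)
    then show ?thesis by (simp add: GL_inv(1)[OF T])
  qed
  then show ?thesis
    unfolding conjugate_by_def by (force simp: GL_def)
qed

section \<open>Affine symmetries of orbit polytopes\<close>

locale finite_matrix_group =
  fixes G :: "(real ^ ('n::{finite,linorder}) ^ ('n::{finite,linorder})) set"
  assumes subgroup_G: "subgroup G GL" and finite_G: "finite G"
begin

section \<open>The group and its action on orbits\<close>

lemma one_mem: "mat 1 \<in> G"
  using subgroup.one_closed[OF subgroup_G] by (simp add: GL_def)

lemma mult_mem: "g \<in> G \<Longrightarrow> h \<in> G \<Longrightarrow> g ** h \<in> G"
  using subgroup.m_closed[OF subgroup_G, of g h] by (simp add: GL_def)

lemma inv_mem: "g \<in> G \<Longrightarrow> inv\<^bsub>GL\<^esub> g \<in> G"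
  using subgroup.m_inv_closed[OF subgroup_G] by blast

lemma invertible_mem: "g \<in> G \<Longrightarrow> invertible g"
  using subgroup.subset[OF subgroup_G] by (auto simp: GL_def)

lemma mult_right_image:
  assumes "h \<in> G"
  shows "inj_on (\<lambda>g. g ** h) G" "(\<lambda>g. g ** h) ` G = G"
proof -
  show inj: "inj_on (\<lambda>g. g ** h) G"
    by (rule inj_on_inverseI[of _ "\<lambda>g. g ** inv\<^bsub>GL\<^esub> h"])
       (simp add: matrix_mul_assoc[symmetric] GL_inv(1)[OF invertible_mem[OF assms]])
  show "(\<lambda>g. g ** h) ` G = G"
    by (rule endo_inj_surj[OF finite_G _ inj]) (use assms mult_mem in auto)
qed

lemma orbit_image:
  assumes "g \<in> G"
  shows "(\<lambda>x. g *v x) ` (orbit_map v ` G) = orbit_map v ` G"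
proof (rule endo_inj_surj)
  show "(\<lambda>x. g *v x) ` (orbit_map v ` G) \<subseteq> orbit_map v ` G"
    using assms mult_mem by (auto simp: matrix_vector_mul_assoc)
  show "inj_on (\<lambda>x. g *v x) (orbit_map v ` G)"
    using inj_matrix_vector_mult[OF invertible_mem[OF assms]] inj_on_subset by blast
qed (simp add: finite_G)

text \<open>The sum of the group elements maps a full-dimensional orbit to a single point, so it
  vanishes and every orbit has barycentre \<open>0\<close>.\<close>

lemma full_dimensional_iff:
  assumes "full_dimensional G v0"
  shows "full_dimensional G v \<longleftrightarrow> span (orbit_map v ` G) = UNIV"
proof -
  define s where "s = \<Sum>G"
  have s: "s *v (h *v x) = s *v x" if "h \<in> G" for h x
  proof -
    have "s ** h = (\<Sum>g\<in>G. g ** h)" by (simp add: s_def sum_matrix_mult_right)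
    also have "\<dots> = \<Sum>((\<lambda>g. g ** h) ` G)"
      by (simp add: sum.reindex[OF mult_right_image(1)[OF that]])
    also have "\<dots> = s" by (simp add: mult_right_image(2)[OF that] s_def)
    finally show ?thesis by (simp add: matrix_vector_mul_assoc)
  qed
  have "affine {x. s *v x = s *v v0}"
    unfolding affine_def
    by (auto simp: matrix_vector_right_distrib matrix_vector_mult_scaleR scaleR_left_distrib[symmetric])
  moreover have "orbit_map v0 ` G \<subseteq> {x. s *v x = s *v v0}" using s by auto
  ultimately have "affine hull (orbit_map v0 ` G) \<subseteq> {x. s *v x = s *v v0}"
    by (simp add: hull_minimal)
  then have c: "s *v x = s *v v0" for x using assms by (auto simp: full_dimensional_def)
  have "s *v v = 0" using c[of 0] c[of v] by simp
  then have zero: "(\<Sum>g\<in>G. g *v v) = 0" by (simp add: s_def sum_matrix_vector)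
  have "card G \<noteq> 0" using one_mem finite_G by auto
  \<comment> \<open>This average is \<open>0\<close>, so the affine hull contains the origin and
    coincides with the linear span.\<close>
  then have "(\<Sum>g\<in>G. inverse (real (card G)) *\<^sub>R (g *v v)) \<in> convex hull (orbit_map v ` G)"
    by (intro convex_sum[OF finite_G convex_convex_hull]) (auto simp: hull_inc)
  then have "0 \<in> affine hull (orbit_map v ` G)"
    using convex_hull_subset_affine_hull by (auto simp: scaleR_sum_right[symmetric] zero)
  from affine_hull_span_0[OF this] show ?thesis by (simp add: full_dimensional_def)
qed

text \<open>A non-empty compact convex set has an extreme point, here an orbit point. Since
  \<open>G\<close> acts transitively on the orbit by linear automorphisms of the polytope, every
  orbit point is then extreme.\<close>

lemma extreme_points_orbit_polytope:
  "{x. x extreme_point_of orbit_polytope G v} = orbit_map v ` G"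
proof
  let ?O = "orbit_map v ` G"
  let ?P = "orbit_polytope G v"
  have P: "?P = convex hull ?O" by (simp add: orbit_polytope_def)
  show "{x. x extreme_point_of ?P} \<subseteq> ?O"
    unfolding P using extreme_point_of_convex_hull by blast
  have "compact ?P" "convex ?P"
    unfolding P using finite_G by (simp_all add: finite_imp_compact_convex_hull)
  from Krein_Milman_Minkowski[OF this] have "?P = convex hull {x. x extreme_point_of ?P}" .
  moreover have "?P \<noteq> {}" using one_mem unfolding P by auto
  ultimately have "{x. x extreme_point_of ?P} \<noteq> {}" by (metis convex_hull_empty)
  then obtain x where x: "x extreme_point_of ?P" by blast
  then obtain h where h: "h \<in> G" "x = h *v v"
    unfolding P using extreme_point_of_convex_hull by blast
  show "?O \<subseteq> {x. x extreme_point_of ?P}"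
  proof
    fix y assume "y \<in> ?O"
    then obtain g where g: "g \<in> G" "y = g *v v" by blast
    define k where "k = g ** inv\<^bsub>GL\<^esub> h"
    have k: "k \<in> G" using g h by (simp add: k_def mult_mem inv_mem)
    have "k ** h = g"
      by (simp add: k_def matrix_mul_assoc[symmetric] GL_inv(2)[OF invertible_mem[OF h(1)]])
    then have y: "y = k *v x" by (simp add: g h matrix_vector_mul_assoc)
    have "(\<lambda>x. k *v x) ` ?P = ?P"
      unfolding P by (simp add: convex_hull_linear_image orbit_image[OF k])
    then have "(\<lambda>x. k *v x) ` {x} face_of ?P"
      using face_of_linear_image[OF _ inj_matrix_vector_mult[OF invertible_mem[OF k]], of "{x}" ?P] x
      by (simp add: face_of_singleton)
    then show "y \<in> {x. x extreme_point_of ?P}" by (simp add: y face_of_singleton)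
  qed
qed

text \<open>Injective linear maps send faces to faces, so preserving the polytope entails preserving
  its vertices, the orbit points. Conversely, linear maps commute with convex hulls.\<close>

lemma AGL_orbit_polytope:
  "AGL (orbit_polytope G v) = {A. invertible A \<and> (\<lambda>x. A *v x) ` (orbit_map v ` G) = orbit_map v ` G}"
proof -
  let ?O = "orbit_map v ` G"
  let ?P = "orbit_polytope G v"
  have "A \<in> AGL ?P \<longleftrightarrow> (\<lambda>x. A *v x) ` ?O = ?O" if A: "invertible A" for A
  proof -
    have inj: "inj (\<lambda>x. A *v x)" by (rule inj_matrix_vector_mult[OF A])
    have lin: "linear (\<lambda>x. A *v x)" by simp
    have "\<exists>L b. linear L \<and> restrict (\<lambda>x. A *v x) ?P = restrict (\<lambda>x. L x + b) ?P"
      by (rule exI[of _ "\<lambda>x. A *v x"], rule exI[of _ 0]) simp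
    then have "A \<in> AGL ?P \<longleftrightarrow> bij_betw (\<lambda>x. A *v x) ?P ?P"
      using A by (simp add: AGL_def affine_symmetries_def GL_def)
    also have "\<dots> \<longleftrightarrow> (\<lambda>x. A *v x) ` ?P = ?P"
      using inj_on_subset[OF inj, of ?P] by (simp add: bij_betw_def)
    also have "\<dots> \<longleftrightarrow> (\<lambda>x. A *v x) ` ?O = ?O"
    proof
      assume "(\<lambda>x. A *v x) ` ?O = ?O"
      then show "(\<lambda>x. A *v x) ` ?P = ?P"
        by (simp add: orbit_polytope_def convex_hull_linear_image)
    next
      assume P: "(\<lambda>x. A *v x) ` ?P = ?P"
      have "A *v x \<in> ?O" if "x \<in> ?O" for x
      proof -
        have "{x} face_of ?P"
          using that unfolding extreme_points_orbit_polytope[symmetric] by (simp add: face_of_singleton)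
        then have "(\<lambda>x. A *v x) ` {x} face_of ?P"
          using face_of_linear_image[OF lin inj, of "{x}" ?P] P by simp
        then show ?thesis
          unfolding extreme_points_orbit_polytope[symmetric] by (simp add: face_of_singleton)
      qed
      then show "(\<lambda>x. A *v x) ` ?O = ?O"
        using finite_G inj_on_subset[OF inj] by (intro endo_inj_surj) auto
    qed
    finally show ?thesis .
  qed
  moreover have "invertible A" if "A \<in> AGL ?P" for A
    using that by (simp add: AGL_def GL_def)
  ultimately show ?thesis by blast
qed

section \<open>Affine symmetries from permutations of the group\<close>

lemma sym_matrix_AGL:
  assumes "\<sigma> \<in> LinSym G (orbit_map v)"
  shows "sym_matrix G (orbit_map v) \<sigma> \<in> AGL (orbit_polytope G v)"
proof -
  have "\<sigma> ` G = G" using assms by (auto simp: LinSym_def permutes_image)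
  have "(\<lambda>x. sym_matrix G (orbit_map v) \<sigma> *v x) ` orbit_map v ` G = (\<lambda>g. orbit_map v (\<sigma> g)) ` G"
    unfolding image_image by (rule image_cong[OF refl sym_matrix(2)[OF assms]])
  also have "\<dots> = orbit_map v ` (\<sigma> ` G)" by (simp only: image_image)
  finally show ?thesis
    unfolding AGL_orbit_polytope using sym_matrix(1)[OF assms] \<open>\<sigma> ` G = G\<close> by simp
qed

lemma orbit_map_inj:
  assumes "{g \<in> G. g *v w = w} = {mat 1}"
  shows "inj_on (orbit_map w) G"
proof (rule inj_onI)
  fix g h assume gh: "g \<in> G" "h \<in> G" "g *v w = h *v w"
  have hi: "inv\<^bsub>GL\<^esub> h ** h = mat 1" "h ** inv\<^bsub>GL\<^esub> h = mat 1"
    using GL_inv invertible_mem gh by blast+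
  have "(inv\<^bsub>GL\<^esub> h ** g) *v w = inv\<^bsub>GL\<^esub> h *v (h *v w)"
    by (simp add: matrix_vector_mul_assoc[symmetric] gh(3))
  also have "\<dots> = w" by (simp add: matrix_vector_mul_assoc hi)
  finally have "inv\<^bsub>GL\<^esub> h ** g \<in> {g \<in> G. g *v w = w}"
    using gh by (simp add: mult_mem inv_mem)
  then have "inv\<^bsub>GL\<^esub> h ** g = mat 1" unfolding assms by simp
  then have "h ** (inv\<^bsub>GL\<^esub> h ** g) = h" by simp
  then show "g = h" by (simp add: matrix_mul_assoc hi)
qed

text \<open>A trivial stabilizer identifies \<open>G\<close> with the orbit, so each permutation of
  vertices lifts to a permutation of \<open>G\<close>.\<close>

lemma AGL_sym_matrix:
  assumes stab: "{g \<in> G. g *v w = w} = {mat 1}" and span: "span (orbit_map w ` G) = UNIV"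
  shows "AGL (orbit_polytope G w) = sym_matrix G (orbit_map w) ` LinSym G (orbit_map w)"
proof
  show "sym_matrix G (orbit_map w) ` LinSym G (orbit_map w) \<subseteq> AGL (orbit_polytope G w)"
    using sym_matrix_AGL by blast
  note inj = orbit_map_inj[OF stab]
  show "AGL (orbit_polytope G w) \<subseteq> sym_matrix G (orbit_map w) ` LinSym G (orbit_map w)"
  proof
    fix A assume "A \<in> AGL (orbit_polytope G w)"
    then have A: "invertible A" "(\<lambda>x. A *v x) ` orbit_map w ` G = orbit_map w ` G"
      by (simp_all add: AGL_orbit_polytope)
    \<comment> \<open>Fixing everything outside \<open>G\<close> is part of
      \<open>permutes\<close>.\<close>
    define \<sigma> where "\<sigma> g = (if g \<in> G then inv_into G (orbit_map w) (A *v (g *v w)) else g)" for g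
    have mem: "A *v (g *v w) \<in> orbit_map w ` G" if "g \<in> G" for g
      using A(2) that by blast
    have \<sigma>: "\<sigma> g \<in> G" "\<sigma> g *v w = A *v (g *v w)" if "g \<in> G" for g
      using that inv_into_into[OF mem[OF that]] f_inv_into_f[OF mem[OF that]] by (simp_all add: \<sigma>_def)
    have inj\<sigma>: "inj_on \<sigma> G"
    proof (rule inj_onI)
      fix g h assume gh: "g \<in> G" "h \<in> G" "\<sigma> g = \<sigma> h"
      then have "A *v (g *v w) = A *v (h *v w)" using \<sigma> by metis
      then have "g *v w = h *v w" using inj_matrix_vector_mult[OF A(1)] by (simp add: inj_def)
      then show "g = h" using inj gh by (simp add: inj_on_def)
    qed
    have "bij_betw \<sigma> G G"
      unfolding bij_betw_def using inj\<sigma> endo_inj_surj[OF finite_G _ inj\<sigma>] \<sigma>(1) by blast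
    then have "\<sigma> permutes G" by (rule bij_imp_permutes) (simp add: \<sigma>_def)
    then have L: "\<sigma> \<in> LinSym G (orbit_map w)"
      using A(1) \<sigma>(2) by (auto simp: LinSym_def GL_def)
    have "A = sym_matrix G (orbit_map w) \<sigma>"
      by (rule spanning_matrix_unique[OF span]) (simp add: sym_matrix(2)[OF L] \<sigma>(2))
    then show "A \<in> sym_matrix G (orbit_map w) ` LinSym G (orbit_map w)" using L by blast
  qed
qed

section \<open>Zariski openness of genericity\<close>

lemma zariski_open_moved: "zariski_open {v. g *v v \<noteq> v}"
proof -
  have eq: "{v. g *v v \<noteq> v} = (\<Union>i. {v. (g *v v) $ i - v $ i \<noteq> 0})" by (auto simp: vec_eq_iff)
  show ?thesis
    unfolding eq
    by (intro zariski_open_UN zariski_open_basic[OF specializes_diff[OF specializes_orbit specializes_var]])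
qed

text \<open>Each condition in \<open>generic\<close> cuts out a non-empty Zariski-open set. For
  spanning orbits one inclusion of symmetry groups is automatic, so equality only excludes the
  finitely many permutations in \<open>?B\<close>.\<close>

lemma zariski_open_generic:
  assumes v0: "full_dimensional G v0"
  shows "zariski_open {v. generic G v} \<and> {v. generic G v} \<noteq> {}"
proof -
  let ?sp = "\<lambda>v. span (orbit_map v ` G) = UNIV"
  let ?B = "{\<sigma>. \<sigma> permutes G} - LinSym G generic_orbit_map"
  let ?U1 = "{v. ?sp v}" and ?U2 = "\<Inter>g\<in>G - {mat 1}. {v. g *v v \<noteq> v}"
    and ?U3 = "\<Inter>\<sigma>\<in>?B. {v. ?sp v \<and> \<sigma> \<notin> LinSym G (orbit_map v)}"
  have sp0: "?sp v0" using full_dimensional_iff[OF v0] v0 by blast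
  have 1: "zariski_open ?U1" "?U1 \<noteq> {}" using sp0 zariski_open_spanning by auto
  have 2: "zariski_open ?U2 \<and> ?U2 \<noteq> {}"
  proof (rule zariski_open_INT)
    show "finite (G - {mat 1})" using finite_G by simp
    fix g assume "g \<in> G - {mat 1}"
    then have "\<exists>v. g *v v \<noteq> mat 1 *v v" using matrix_eq by blast
    then show "zariski_open {v. g *v v \<noteq> v} \<and> {v. g *v v \<noteq> v} \<noteq> {}"
      by (simp add: zariski_open_moved)
  qed
  have 3: "zariski_open ?U3 \<and> ?U3 \<noteq> {}"
  proof (rule zariski_open_INT)
    show "finite ?B" using finite_permutations[OF finite_G] by simp
    show "zariski_open {v. ?sp v \<and> \<sigma> \<notin> LinSym G (orbit_map v)} \<and> {v. ?sp v \<and> \<sigma> \<notin> LinSym G (orbit_map v)} \<noteq> {}"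
      if "\<sigma> \<in> ?B" for \<sigma>
      using that zariski_open_not_LinSym not_LinSym_nonempty[OF _ _ sp0] by blast
  qed
  have gen: "{v. generic G v} = ?U1 \<inter> (?U2 \<inter> ?U3)"
  proof (rule Set.set_eqI)
    fix v
    have stab: "{g \<in> G. g *v v = v} = {mat 1} \<longleftrightarrow> v \<in> ?U2"
      using one_mem by auto
    have sym: "LinSym G generic_orbit_map = LinSym G (orbit_map v) \<longleftrightarrow> v \<in> ?U3" if "?sp v"
    proof -
      have "LinSym G (orbit_map v) \<subseteq> {\<sigma>. \<sigma> permutes G}" by (auto simp: LinSym_def)
      then show ?thesis using LinSym_generic_subset[OF that] that by blast
    qed
    show "v \<in> {v. generic G v} \<longleftrightarrow> v \<in> ?U1 \<inter> (?U2 \<inter> ?U3)"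
      unfolding generic_def full_dimensional_iff[OF v0] Int_iff mem_Collect_eq
      by (simp only: stab sym cong: conj_cong)
  qed
  show ?thesis
    unfolding gen using 1 2 3 by (simp add: zariski_open_Int zariski_open_Int_nonempty)
qed

end

theorem theorem1:
  fixes G :: "(real ^ ('n::{finite,linorder}) ^ ('n::{finite,linorder})) set"
  assumes "subgroup G GL" and "finite G"
    and "\<exists>v. full_dimensional G v"
  shows "(\<exists>S :: 'n real_mpoly set. S \<noteq> {} \<and> 0 \<notin> S \<and>
            {v. \<not> generic G v} = {v. \<forall>p\<in>S. eval_mpoly p v = 0}) \<and>
         (\<forall>v w. generic G v \<longrightarrow> generic G w \<longrightarrow>
            (\<exists>A\<in>carrier GL. AGL (orbit_polytope G w) = conjugate_by A (AGL (orbit_polytope G v)))) \<and>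
         (\<forall>v w. full_dimensional G v \<longrightarrow> generic G w \<longrightarrow>
            (\<exists>A\<in>carrier GL. conjugate_by A (AGL (orbit_polytope G w)) \<subseteq> AGL (orbit_polytope G v)))"
proof -
  interpret finite_matrix_group G using assms(1,2) by (rule finite_matrix_group.intro)
  obtain v0 where v0: "full_dimensional G v0" using assms by blast
  let ?H = "LinSym G generic_orbit_map"
  have AGL_generic: "AGL (orbit_polytope G w) = sym_matrix G (orbit_map w) ` ?H" if "generic G w" for w
  proof -
    have w: "{g \<in> G. g *v w = w} = {mat 1}" "span (orbit_map w ` G) = UNIV"
      and L: "?H = LinSym G (orbit_map w)"
      using that unfolding generic_def full_dimensional_iff[OF v0] by blast+
    show ?thesis unfolding L by (rule AGL_sym_matrix[OF w])
  qed
  \<comment> \<open>Common source of claims (2) and (3): the image of \<open>?H\<close> at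
    \<open>v\<close> is all of the affine symmetry group if \<open>v\<close> is generic, and lies
    inside it whenever the orbit polytope is full-dimensional.\<close>
  have conj: "\<exists>A\<in>carrier GL. conjugate_by A (AGL (orbit_polytope G w)) = sym_matrix G (orbit_map v) ` ?H"
    if "full_dimensional G v" "generic G w" for v w
  proof -
    have sp: "span (orbit_map v ` G) = UNIV" "span (orbit_map w ` G) = UNIV"
      using that unfolding generic_def full_dimensional_iff[OF v0] by blast+
    obtain T where T: "invertible T"
      "\<And>\<sigma>. \<sigma> \<in> ?H \<Longrightarrow> sym_matrix G (orbit_map v) \<sigma> ** T = T ** sym_matrix G (orbit_map w) \<sigma>"
      by (rule sym_matrices_conjugate[OF finite_G sp]) (rule that)
    have "conjugate_by T (AGL (orbit_polytope G w)) = sym_matrix G (orbit_map v) ` ?H"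
      unfolding AGL_generic[OF that(2)] by (rule conjugate_by_image[OF T])
    then show ?thesis using T(1) by (auto simp: GL_def)
  qed
  have sub: "sym_matrix G (orbit_map v) ` ?H \<subseteq> AGL (orbit_polytope G v)" if "full_dimensional G v" for v
  proof -
    have "?H \<subseteq> LinSym G (orbit_map v)"
      using that full_dimensional_iff[OF v0] LinSym_generic_subset by blast
    then show ?thesis using sym_matrix_AGL by blast
  qed
  have "\<exists>A\<in>carrier GL. conjugate_by A (AGL (orbit_polytope G w)) \<subseteq> AGL (orbit_polytope G v)"
    if "full_dimensional G v" "generic G w" for v w
  proof -
    from conj[OF that] obtain A where "A \<in> carrier GL"
      "conjugate_by A (AGL (orbit_polytope G w)) = sym_matrix G (orbit_map v) ` ?H" ..
    then show ?thesis using sub[OF that(1)] by (intro bexI[of _ A]) simp_all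
  qed
  moreover have "\<exists>A\<in>carrier GL. AGL (orbit_polytope G w) = conjugate_by A (AGL (orbit_polytope G v))"
    if "generic G v" "generic G w" for v w
  proof -
    have "full_dimensional G w" using that by (simp add: generic_def)
    from conj[OF this that(1)] obtain A where "A \<in> carrier GL"
      "conjugate_by A (AGL (orbit_polytope G v)) = sym_matrix G (orbit_map w) ` ?H" ..
    then show ?thesis unfolding AGL_generic[OF that(2)] by (intro bexI[of _ A]) simp_all
  qed
  moreover have "\<exists>S :: 'n real_mpoly set. S \<noteq> {} \<and> 0 \<notin> S \<and>
      {v. \<not> generic G v} = {v. \<forall>p\<in>S. eval_mpoly p v = 0}"
    using zariski_closed_zeros[of "{v. generic G v}"] zariski_open_generic[OF v0]
    by (simp add: Collect_neg_eq)
  ultimately show ?thesis by blast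
qed

end
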